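(* Let $n\geq 1$ be an integer and let $q,q'\in[0,1)$ with $q\neq q'$. Then the algebras $\mathcal{A}(S^{2n+1}_q)$ and $\mathcal{A}(S^{2n+1}_{q'})$ are not isomorphic (as unital $*$-algebras over $\mathbb{C}$).
   Context: Throughout, an algebra is a unital associative $*$-algebra over $\mathbb{C}$ (with conjugate-linear involution), and a homomorphism (in particular an isomorphism) is a unital $*$-homomorphism. An ideal is a two-sided ideal closed under $*$. Empty sums are zero. For $n\in\mathbb{N}=\{0,1,2,\ldots\}$ and a real number $q\ge 0$, $\mathcal{A}(S^{2n+1}_q)$ is the universal unital $*$-algebra generated by elements $z_0,\ldots,z_n$ (and their adjoints $z_0^*,\ldots,z_n^*$) with relations: \begin{align*} z_jz_i &=q\,z_iz_j && \text{for all } 0\leq i<j\leq n,\\ z_i^*z_j &=q\,z_jz_i^* && \text{for all } 0\leq i, j\leq n \text{ with } i\neq j,\\ z_i^*z_i &=z_iz_i^*+(1-q^2)\sum_{j=i+1}^n z_jz_j^* && \text{for all } 0\leq i\leq n,\\ z_0z_0^*+z_1z_1^* &+\ldots+z_nz_n^*=1 . \end{align*} That is, it is the quotient of the free unital algebra $\mathbb{C}\langle z_0,z_0^*,\ldots,z_n,z_n^*\rangle$, with involution determined by $z_i\mapsto z_i^*$, by the two-sided $*$-ideal generated by these relations. *)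

theory Defs
  imports Complex_Main "HOL-Algebra.Module" "HOL-Algebra.QuotRing" "HOL-Library.Poly_Mapping"
begin

section \<open>Unital \<open>*\<close>-algebras over the complex numbers\<close>

text \<open>
  The library's locale \<^locale>\<open>algebra\<close> requires commutativity, so only the record
  \<^typ>\<open>(complex, 'a) module\<close> is reused here. The zero algebra is not excluded.
\<close>

record 'a star_alg = "(complex, 'a) module" +
  adj :: "'a \<Rightarrow> 'a"

locale star_algebra = ring A for A :: "('a, 'm) star_alg_scheme" (structure) +
  assumes smult_closed [simp, intro]:
      "x \<in> carrier A \<Longrightarrow> c \<odot> x \<in> carrier A"
    and smult_l_distr:
      "x \<in> carrier A \<Longrightarrow> (c + d) \<odot> x = c \<odot> x \<oplus> d \<odot> x"
    and smult_r_distr: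
      "\<lbrakk>x \<in> carrier A; y \<in> carrier A\<rbrakk> \<Longrightarrow> c \<odot> (x \<oplus> y) = c \<odot> x \<oplus> c \<odot> y"
    and smult_smult:
      "x \<in> carrier A \<Longrightarrow> (c * d) \<odot> x = c \<odot> (d \<odot> x)"
    and smult_1 [simp]:
      "x \<in> carrier A \<Longrightarrow> 1 \<odot> x = x"
    and smult_mult_l:
      "\<lbrakk>x \<in> carrier A; y \<in> carrier A\<rbrakk> \<Longrightarrow> (c \<odot> x) \<otimes> y = c \<odot> (x \<otimes> y)"
    and smult_mult_r:
      "\<lbrakk>x \<in> carrier A; y \<in> carrier A\<rbrakk> \<Longrightarrow> x \<otimes> (c \<odot> y) = c \<odot> (x \<otimes> y)"
    and adj_closed [simp, intro]:
      "x \<in> carrier A \<Longrightarrow> adj A x \<in> carrier A"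
    and adj_adj [simp]:
      "x \<in> carrier A \<Longrightarrow> adj A (adj A x) = x"
    and adj_add:
      "\<lbrakk>x \<in> carrier A; y \<in> carrier A\<rbrakk> \<Longrightarrow> adj A (x \<oplus> y) = adj A x \<oplus> adj A y"
    and adj_smult:
      "x \<in> carrier A \<Longrightarrow> adj A (c \<odot> x) = cnj c \<odot> adj A x"
    and adj_mult:
      "\<lbrakk>x \<in> carrier A; y \<in> carrier A\<rbrakk> \<Longrightarrow> adj A (x \<otimes> y) = adj A y \<otimes> adj A x"

definition star_alg_hom ::
    "('a, 'm) star_alg_scheme \<Rightarrow> ('b, 'n) star_alg_scheme \<Rightarrow> ('a \<Rightarrow> 'b) set"
  where "star_alg_hom A B =
    {h \<in> ring_hom A B.
      (\<forall>c. \<forall>x\<in>carrier A. h (c \<odot>\<^bsub>A\<^esub> x) = c \<odot>\<^bsub>B\<^esub> h x) \<and>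
      (\<forall>x\<in>carrier A. h (adj A x) = adj B (h x))}"

definition star_alg_iso ::
    "('a, 'm) star_alg_scheme \<Rightarrow> ('b, 'n) star_alg_scheme \<Rightarrow> ('a \<Rightarrow> 'b) set"
  where "star_alg_iso A B =
    {h \<in> star_alg_hom A B. bij_betw h (carrier A) (carrier B)}"

definition star_alg_isomorphic ::
    "('a, 'm) star_alg_scheme \<Rightarrow> ('b, 'n) star_alg_scheme \<Rightarrow> bool"
  where "star_alg_isomorphic A B \<longleftrightarrow> star_alg_iso A B \<noteq> {}"


section \<open>\<open>*\<close>-ideals and quotients\<close>

locale star_ideal = ideal I A + star_algebra A for I and A :: "('a, 'm) star_alg_scheme" (structure) +
  assumes adj_ideal: "x \<in> I \<Longrightarrow> adj A x \<in> I"

definition gen_star_ideal :: "('a, 'm) star_alg_scheme \<Rightarrow> 'a set \<Rightarrow> 'a set"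
  where "gen_star_ideal A S = \<Inter>{I. star_ideal I A \<and> S \<subseteq> I}"

text \<open>
  The operations on cosets are unions over representatives, as in \<^const>\<open>rcoset_mult\<close>.
  (The plain image of a coset under multiplication by \<open>0\<close> is not a coset.)
\<close>

definition star_quot :: "('a, 'm) star_alg_scheme \<Rightarrow> 'a set \<Rightarrow> 'a set star_alg"
  where "star_quot A I =
    \<lparr>carrier = carrier (A Quot I), mult = mult (A Quot I), one = one (A Quot I),
     zero = zero (A Quot I), add = add (A Quot I),
     smult = (\<lambda>c X. \<Union>x\<in>X. I +>\<^bsub>A\<^esub> (c \<odot>\<^bsub>A\<^esub> x)),
     adj = (\<lambda>X. \<Union>x\<in>X. I +>\<^bsub>A\<^esub> adj A x)\<rparr>"

lemma (in star_algebra) gen_star_ideal: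
  assumes "S \<subseteq> carrier A"
  shows "star_ideal (gen_star_ideal A S) A"
proof -
  let ?F = "{I. star_ideal I A \<and> S \<subseteq> I}"
  have F: "ideal I A" "\<And>x. x \<in> I \<Longrightarrow> adj A x \<in> I" if "I \<in> ?F" for I
    using that star_ideal.axioms(1) star_ideal.adj_ideal by auto
  have "star_ideal (carrier A) A"
    by (intro star_ideal.intro star_ideal_axioms.intro oneideal star_algebra_axioms) simp
  with assms have ne: "?F \<noteq> {}"
    by blast
  have "ideal (\<Inter>?F) A"
    using i_Intersect[OF _ ne] F(1) by blast
  then show ?thesis
    unfolding gen_star_ideal_def
    by (intro star_ideal.intro star_ideal_axioms.intro star_algebra_axioms) (use F(2) in blast)+
qed

context star_ideal
begin

lemma smult_ideal: "x \<in> I \<Longrightarrow> c \<odot> x \<in> I"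
  by (metis I_l_closed Icarr l_one one_closed smult_closed smult_mult_l)

lemma UN_cosets:
  assumes x: "x \<in> carrier A"
    and f: "\<And>y. y \<in> carrier A \<Longrightarrow> f y \<in> carrier A"
    and add: "\<And>y z. \<lbrakk>y \<in> carrier A; z \<in> carrier A\<rbrakk> \<Longrightarrow> f (y \<oplus> z) = f y \<oplus> f z"
    and ideal: "\<And>y. y \<in> I \<Longrightarrow> f y \<in> I"
  shows "(\<Union>y\<in>I +> x. I +> f y) = I +> f x"
proof -
  have "I +> f y = I +> f x" if "y \<in> I +> x" for y
  proof -
    from that obtain i where i: "i \<in> I" "y = i \<oplus> x"
      by (auto simp: a_r_coset_def r_coset_def)
    then have "f y = f i \<oplus> f x"
      using add x Icarr by simp
    then have "f y \<in> I +> f x"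
      using ideal i by (auto simp: a_r_coset_def r_coset_def)
    then show ?thesis
      using a_repr_independence[OF _ f[OF x]] is_additive_subgroup
      by (metis a_repr_independence' f x)
  qed
  moreover have "x \<in> I +> x"
    using x by (rule a_rcos_self)
  ultimately show ?thesis
    by blast
qed

lemma star_quot_simps:
  "carrier (star_quot A I) = (\<lambda>x. I +> x) ` carrier A"
  "one (star_quot A I) = I +> \<one>"
  "zero (star_quot A I) = I"
  "\<lbrakk>x \<in> carrier A; y \<in> carrier A\<rbrakk> \<Longrightarrow>
    mult (star_quot A I) (I +> x) (I +> y) = I +> (x \<otimes> y)"
  "\<lbrakk>x \<in> carrier A; y \<in> carrier A\<rbrakk> \<Longrightarrow>
    add (star_quot A I) (I +> x) (I +> y) = I +> (x \<oplus> y)"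
  "x \<in> carrier A \<Longrightarrow> smult (star_quot A I) c (I +> x) = I +> (c \<odot> x)"
  "x \<in> carrier A \<Longrightarrow> adj (star_quot A I) (I +> x) = I +> adj A x"
  by (simp_all add: star_quot_def UN_cosets smult_r_distr adj_add smult_ideal adj_ideal)
    (auto simp: FactRing_simps rcoset_mult_add a_rcos_sum)

lemma star_algebra_quot: "star_algebra (star_quot A I)"
proof (rule star_algebra.intro)
  interpret Q: ring "A Quot I"
    by (rule quotient_is_ring)
  have ops: "carrier (star_quot A I) = carrier (A Quot I)" "mult (star_quot A I) = mult (A Quot I)"
    "one (star_quot A I) = one (A Quot I)" "zero (star_quot A I) = zero (A Quot I)"
    "add (star_quot A I) = add (A Quot I)"
    by (simp_all add: star_quot_def)
  show "ring (star_quot A I)"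
  proof (rule ringI)
    show "abelian_group (star_quot A I)"
    proof (rule abelian_groupI)
      fix x assume "x \<in> carrier (star_quot A I)"
      then show "\<exists>y\<in>carrier (star_quot A I).
          y \<oplus>\<^bsub>star_quot A I\<^esub> x = \<zero>\<^bsub>star_quot A I\<^esub>"
        unfolding ops using Q.l_neg Q.a_inv_closed by blast
    qed (simp_all add: ops Q.a_ac)
    show "Group.monoid (star_quot A I)"
      by (rule monoidI) (simp_all add: ops Q.m_assoc)
  qed (simp_all add: ops Q.l_distr Q.r_distr)
  show "star_algebra_axioms (star_quot A I)"
    by unfold_locales
      (auto simp: star_quot_simps smult_l_distr smult_r_distr smult_smult smult_mult_l
        smult_mult_r adj_add adj_smult adj_mult)
qed

end


section \<open>The free \<open>*\<close>-algebra\<close>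

text \<open>
  Words in the generators and their formal adjoints. The additive notation for
  concatenation makes the multiplication of \<^typ>\<open>'k \<Rightarrow>\<^sub>0 complex\<close> the product of
  noncommutative polynomials.
\<close>

datatype 'g letter = Gen 'g | Adj 'g

datatype 'g word = Word (letters: "'g letter list")

instantiation word :: (type) monoid_add
begin

definition zero_word_def: "0 = Word []"

definition plus_word_def: "v + w = Word (letters v @ letters w)"

instance
  by standard (simp_all add: zero_word_def plus_word_def)

end

fun letter_base :: "'g letter \<Rightarrow> 'g" where
  "letter_base (Gen g) = g"
| "letter_base (Adj g) = g"

fun adj_letter :: "'g letter \<Rightarrow> 'g letter" where
  "adj_letter (Gen g) = Adj g"
| "adj_letter (Adj g) = Gen g"

definition adj_word :: "'g word \<Rightarrow> 'g word"
  where "adj_word w = Word (rev (map adj_letter (letters w)))"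

type_synonym 'g ncpoly = "'g word \<Rightarrow>\<^sub>0 complex"

definition adj_poly :: "'g ncpoly \<Rightarrow> 'g ncpoly"
  where "adj_poly p =
    (\<Sum>w\<in>Poly_Mapping.keys p.
      Poly_Mapping.single (adj_word w) (cnj (Poly_Mapping.lookup p w)))"

definition free_star_alg :: "'g set \<Rightarrow> 'g ncpoly star_alg"
  where "free_star_alg G =
    \<lparr>carrier = {p. \<forall>w\<in>Poly_Mapping.keys p. letter_base ` set (letters w) \<subseteq> G},
     mult = (*), one = 1, zero = 0, add = (+),
     smult = (\<lambda>c p. Poly_Mapping.single 0 c * p),
     adj = adj_poly\<rparr>"

definition free_gen :: "'g \<Rightarrow> 'g ncpoly"
  where "free_gen g = Poly_Mapping.single (Word [Gen g]) 1"

lemma adj_letter_adj_letter [simp]: "adj_letter (adj_letter l) = l"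
  by (cases l) simp_all

lemma letter_base_adj_letter [simp]: "letter_base (adj_letter l) = letter_base l"
  by (cases l) simp_all

lemma adj_word_adj_word [simp]: "adj_word (adj_word w) = w"
  by (simp add: adj_word_def rev_map comp_def)

lemma adj_word_zero [simp]: "adj_word 0 = 0"
  by (simp add: adj_word_def zero_word_def)

lemma adj_word_plus: "adj_word (v + w) = adj_word w + adj_word v"
  by (simp add: adj_word_def plus_word_def)

lemma letter_base_adj_word [simp]: "letter_base ` set (letters (adj_word w)) = letter_base ` set (letters w)"
  by (force simp: adj_word_def image_image)

lemma lookup_adj_poly [simp]:
  "Poly_Mapping.lookup (adj_poly p) w = cnj (Poly_Mapping.lookup p (adj_word w))"
proof -
  have *: "adj_word v = w \<longleftrightarrow> v = adj_word w" for v
    by (metis adj_word_adj_word)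
  show ?thesis
    by (auto simp: adj_poly_def lookup_sum lookup_single when_def * not_in_keys_iff_lookup_eq_zero)
qed

lemma keys_adj_poly: "Poly_Mapping.keys (adj_poly p) = adj_word ` Poly_Mapping.keys p"
  by (force simp: in_keys_iff image_iff intro: adj_word_adj_word[symmetric])

lemma adj_poly_single [simp]:
  "adj_poly (Poly_Mapping.single w c) = Poly_Mapping.single (adj_word w) (cnj c)"
  by (rule poly_mapping_eqI) (auto simp: lookup_single when_def)

lemma adj_poly_zero [simp]: "adj_poly 0 = 0"
  by (simp add: adj_poly_def)

lemma adj_free_gen: "adj_poly (free_gen g) = Poly_Mapping.single (Word [Adj g]) 1"
  by (simp add: free_gen_def adj_word_def)

lemma adj_poly_add: "adj_poly (p + q) = adj_poly p + adj_poly q"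
  by (rule poly_mapping_eqI) (simp add: lookup_add)

lemma ncpoly_induct:
  fixes p :: "'g ncpoly"
  assumes "P 0" "\<And>w c. P (Poly_Mapping.single w c)" "\<And>p q. P p \<Longrightarrow> P q \<Longrightarrow> P (p + q)"
  shows "P p"
proof -
  have "P (\<Sum>w\<in>K. Poly_Mapping.single w (Poly_Mapping.lookup p w))" for K
    by (induction K rule: infinite_finite_induct) (auto intro: assms)
  moreover have "p = (\<Sum>w\<in>Poly_Mapping.keys p. Poly_Mapping.single w (Poly_Mapping.lookup p w))"
    by (rule poly_mapping_eqI)
      (auto simp: lookup_sum lookup_single when_def not_in_keys_iff_lookup_eq_zero)
  ultimately show ?thesis
    by metis
qed

lemma adj_poly_mult: "adj_poly (p * q) = adj_poly q * adj_poly p"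
proof (induction p rule: ncpoly_induct)
  case (2 v c)
  show ?case
    by (induction q rule: ncpoly_induct)
      (simp_all add: mult_single adj_word_plus adj_poly_add distrib_left distrib_right mult.commute)
qed (simp_all add: adj_poly_add distrib_left distrib_right)

lemma single_0_commute:
  fixes p :: "'g ncpoly"
  shows "p * Poly_Mapping.single 0 c = Poly_Mapping.single 0 c * p"
  by (induction p rule: ncpoly_induct) (simp_all add: mult_single distrib_left distrib_right mult.commute)

lemma star_algebra_free: "star_algebra (free_star_alg G)"
proof (rule star_algebra.intro)
  let ?A = "free_star_alg G"
  have mult: "p * q \<in> carrier ?A" if "p \<in> carrier ?A" "q \<in> carrier ?A" for p q
  proof -
    have "letter_base ` set (letters w) \<subseteq> G" if w: "w \<in> Poly_Mapping.keys (p * q)" for w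
    proof -
      obtain u v where "u \<in> Poly_Mapping.keys p" "v \<in> Poly_Mapping.keys q" "w = u + v"
        using keys_mult[of p q] w by blast
      with \<open>p \<in> carrier ?A\<close> \<open>q \<in> carrier ?A\<close> show ?thesis
        by (fastforce simp: free_star_alg_def plus_word_def)
    qed
    then show ?thesis
      by (simp add: free_star_alg_def)
  qed
  have add: "p + q \<in> carrier ?A" if "p \<in> carrier ?A" "q \<in> carrier ?A" for p q
    using that Poly_Mapping.keys_add[of p q] by (fastforce simp: free_star_alg_def)
  have const: "Poly_Mapping.single 0 c \<in> carrier ?A" for c
    by (auto simp: free_star_alg_def zero_word_def split: if_splits)
  have one: "1 \<in> carrier ?A"
    using const[of 1] by simp
  have uminus: "- p \<in> carrier ?A" if "p \<in> carrier ?A" for p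
    using that by (simp add: free_star_alg_def)
  have ops: "mult ?A = (*)" "one ?A = 1" "zero ?A = 0" "add ?A = (+)"
    by (simp_all add: free_star_alg_def)
  have zero: "0 \<in> carrier ?A"
    using const[of 0] by simp
  show "ring ?A"
  proof (rule ringI)
    show "abelian_group ?A"
    proof (rule abelian_groupI)
      fix p assume "p \<in> carrier ?A"
      then show "\<exists>q\<in>carrier ?A. q \<oplus>\<^bsub>?A\<^esub> p = \<zero>\<^bsub>?A\<^esub>"
        using uminus by (intro bexI[of _ "- p"]) (simp_all add: ops)
    qed (simp_all add: ops add zero add_ac)
    show "Group.monoid ?A"
      by (rule monoidI) (simp_all add: ops mult one mult.assoc)
  qed (simp_all add: ops distrib_left distrib_right)
  show "star_algebra_axioms ?A"
  proof
    fix p q c d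
    assume p: "p \<in> carrier ?A"
    show "c \<odot>\<^bsub>?A\<^esub> p \<in> carrier ?A"
      using mult[OF const p] by (simp add: free_star_alg_def)
    show "(c + d) \<odot>\<^bsub>?A\<^esub> p = c \<odot>\<^bsub>?A\<^esub> p \<oplus>\<^bsub>?A\<^esub> d \<odot>\<^bsub>?A\<^esub> p"
      by (simp add: free_star_alg_def single_add distrib_right)
    show "(c * d) \<odot>\<^bsub>?A\<^esub> p = c \<odot>\<^bsub>?A\<^esub> (d \<odot>\<^bsub>?A\<^esub> p)"
      by (simp add: free_star_alg_def mult_single flip: mult.assoc)
    show "1 \<odot>\<^bsub>?A\<^esub> p = p"
      by (simp add: free_star_alg_def)
    show "adj ?A p \<in> carrier ?A"
      using p by (auto simp: free_star_alg_def keys_adj_poly simp del: image_subset_iff)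
    show "adj ?A (adj ?A p) = p"
      by (simp add: free_star_alg_def poly_mapping_eqI)
    show "adj ?A (c \<odot>\<^bsub>?A\<^esub> p) = cnj c \<odot>\<^bsub>?A\<^esub> adj ?A p"
      by (simp add: free_star_alg_def adj_poly_mult single_0_commute)
    show "c \<odot>\<^bsub>?A\<^esub> (p \<oplus>\<^bsub>?A\<^esub> q) = c \<odot>\<^bsub>?A\<^esub> p \<oplus>\<^bsub>?A\<^esub> c \<odot>\<^bsub>?A\<^esub> q"
      by (simp add: free_star_alg_def distrib_left)
    show "(c \<odot>\<^bsub>?A\<^esub> p) \<otimes>\<^bsub>?A\<^esub> q = c \<odot>\<^bsub>?A\<^esub> (p \<otimes>\<^bsub>?A\<^esub> q)"
      by (simp add: free_star_alg_def mult.assoc)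
    show "p \<otimes>\<^bsub>?A\<^esub> (c \<odot>\<^bsub>?A\<^esub> q) = c \<odot>\<^bsub>?A\<^esub> (p \<otimes>\<^bsub>?A\<^esub> q)"
      by (simp add: free_star_alg_def single_0_commute flip: mult.assoc)
    show "adj ?A (p \<oplus>\<^bsub>?A\<^esub> q) = adj ?A p \<oplus>\<^bsub>?A\<^esub> adj ?A q"
      by (simp add: free_star_alg_def adj_poly_add)
    show "adj ?A (p \<otimes>\<^bsub>?A\<^esub> q) = adj ?A q \<otimes>\<^bsub>?A\<^esub> adj ?A p"
      by (simp add: free_star_alg_def adj_poly_mult)
  qed
qed


section \<open>Odd-dimensional quantum spheres\<close>

abbreviation z_gen :: "nat \<Rightarrow> nat ncpoly"
  where "z_gen i \<equiv> free_gen i"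

abbreviation z_adj :: "nat \<Rightarrow> nat ncpoly"
  where "z_adj i \<equiv> adj_poly (free_gen i)"

abbreviation scal :: "real \<Rightarrow> nat ncpoly"
  where "scal r \<equiv> Poly_Mapping.single 0 (complex_of_real r)"

text \<open>A relation \<open>l = r\<close> is represented by \<open>l - r\<close>.\<close>

definition sphere_relations :: "nat \<Rightarrow> real \<Rightarrow> nat ncpoly set"
  where "sphere_relations n q =
    {z_gen j * z_gen i - scal q * (z_gen i * z_gen j) | i j. i < j \<and> j \<le> n} \<union>
    {z_adj i * z_gen j - scal q * (z_gen j * z_adj i) | i j. i \<le> n \<and> j \<le> n \<and> i \<noteq> j} \<union>
    {z_adj i * z_gen i -
      (z_gen i * z_adj i + scal (1 - q\<^sup>2) * (\<Sum>j = i + 1..n. z_gen j * z_adj j)) | i. i \<le> n} \<union>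
    {(\<Sum>i = 0..n. z_gen i * z_adj i) - 1}"

definition quantum_sphere :: "nat \<Rightarrow> real \<Rightarrow> nat ncpoly set star_alg"
  where "quantum_sphere n q =
    star_quot (free_star_alg {0..n})
      (gen_star_ideal (free_star_alg {0..n}) (sphere_relations n q))"

lemma sphere_relations_subset: "sphere_relations n q \<subseteq> carrier (free_star_alg {0..n})"
proof -
  let ?A = "free_star_alg {0..n}"
  interpret A: star_algebra ?A
    by (rule star_algebra_free)
  have add: "a + b \<in> carrier ?A" if "a \<in> carrier ?A" "b \<in> carrier ?A" for a b
    using A.a_closed[OF that] by (simp add: free_star_alg_def)
  have mult: "a * b \<in> carrier ?A" if "a \<in> carrier ?A" "b \<in> carrier ?A" for a b
    using A.m_closed[OF that] by (simp add: free_star_alg_def)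
  have scal: "Poly_Mapping.single 0 c * a \<in> carrier ?A" if "a \<in> carrier ?A" for a c
    using A.smult_closed[OF that, of c] by (simp add: free_star_alg_def)
  have one: "1 \<in> carrier ?A"
    using A.one_closed by (simp add: free_star_alg_def)
  have uminus: "- a \<in> carrier ?A" if "a \<in> carrier ?A" for a
    using that by (simp add: free_star_alg_def)
  have diff: "a - b \<in> carrier ?A" if "a \<in> carrier ?A" "b \<in> carrier ?A" for a b
    using add[OF that(1) uminus[OF that(2)]] by simp
  have z: "z_gen i \<in> carrier ?A" if "i \<le> n" for i
    using that by (simp add: free_star_alg_def free_gen_def)
  have zs: "z_adj i \<in> carrier ?A" if "i \<le> n" for i
    using that by (simp add: free_star_alg_def adj_free_gen)
  have sum: "(\<Sum>i\<in>K. z_gen i * z_adj i) \<in> carrier ?A" if "K \<subseteq> {..n}" for K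
    using finite_subset[OF that finite_atMost] that
  proof (induction K rule: finite_induct)
    case empty
    show ?case by (simp add: free_star_alg_def)
  next
    case (insert i K)
    then show ?case using add mult z zs by simp
  qed
  show ?thesis
    unfolding sphere_relations_def Un_subset_iff
    by (intro conjI; clarify; intro diff add mult scal one z zs sum; simp)
qed

theorem star_algebra_quantum_sphere: "star_algebra (quantum_sphere n q)"
  unfolding quantum_sphere_def
  by (intro star_ideal.star_algebra_quot star_algebra.gen_star_ideal star_algebra_free
      sphere_relations_subset)

end

theory Submission
  imports Defs "HOL-Computational_Algebra.Polynomial"
begin

text \<open>
  The parameter \<open>q\<close> is recovered from extensions between one-dimensional modules.

  In the algebra of functions on the sphere with parameter \<open>q \<in> [0,1)\<close>, every unital algebra
  homomorphism \<open>\<chi>\<close> to the complex numbers kills \<open>z\<^sub>i\<close> and its adjoint for \<open>i > 0\<close>, hence is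
  determined by the number \<open>\<chi> z\<^sub>0\<close>, which is nonzero. Call a linear functional \<open>D\<close> with
  \<open>D (x y) = \<chi> x * D y + D x * \<psi> y\<close> a derivation from \<open>\<chi>\<close> to \<open>\<psi>\<close>; the multiples of \<open>\<psi> - \<chi>\<close> are
  the inner ones. If \<open>\<chi> \<noteq> \<psi>\<close>, subtracting an inner derivation makes \<open>D z\<^sub>0\<close> vanish. Applying
  \<open>D\<close> to \<open>z\<^sub>j z\<^sub>0 = q z\<^sub>0 z\<^sub>j\<close> then gives \<open>D z\<^sub>j * \<psi> z\<^sub>0 = q * \<chi> z\<^sub>0 * D z\<^sub>j\<close>, and the same holds for the
  adjoints of the \<open>z\<^sub>j\<close>. So a noninner derivation from \<open>\<chi>\<close> to \<open>\<psi>\<close> forces \<open>\<psi> z\<^sub>0 = q * \<chi> z\<^sub>0\<close>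
  (\<open>sphere_derivation_inner\<close>). Conversely, when the parameter \<open>q'\<close> is positive, each nonzero \<open>\<mu>\<close> is
  the value at \<open>z\<^sub>0\<close> of a character \<open>\<chi>\<^sub>\<mu>\<close>, and a noninner derivation leads from it to the
  character with value \<open>q' * \<mu>\<close> (\<open>point_ideal\<close>).

  An isomorphism \<open>h\<close> from the sphere of parameter \<open>q\<close> to that of parameter \<open>q' > 0\<close> pulls all this
  back, so \<open>\<phi> \<mu> = \<chi>\<^sub>\<mu> (h z\<^sub>0)\<close> satisfies \<open>\<phi> (q' * \<mu>) = q * \<phi> \<mu>\<close> and has no zeros. As \<open>\<phi>\<close> is a
  Laurent polynomial (\<open>point_char_Laurent\<close>), comparing coefficients shows that \<open>q\<close> is an integral
  power of \<open>q'\<close>, with a positive exponent because both lie in \<open>[0,1)\<close>. Hence \<open>0 < q \<le> q'\<close>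
  (\<open>isomorphic_spheres_le\<close>), and the inverse isomorphism yields \<open>q' \<le> q\<close>.
\<close>

section \<open>Characters and twisted derivations\<close>

definition linear_functional :: "('a, 'm) star_alg_scheme \<Rightarrow> ('a \<Rightarrow> complex) \<Rightarrow> bool"
  where "linear_functional A f \<longleftrightarrow>
    (\<forall>x\<in>carrier A. \<forall>y\<in>carrier A. f (x \<oplus>\<^bsub>A\<^esub> y) = f x + f y) \<and>
    (\<forall>c. \<forall>x\<in>carrier A. f (c \<odot>\<^bsub>A\<^esub> x) = c * f x)"

definition character :: "('a, 'm) star_alg_scheme \<Rightarrow> ('a \<Rightarrow> complex) \<Rightarrow> bool"
  where "character A \<chi> \<longleftrightarrow> linear_functional A \<chi> \<and> \<chi> \<one>\<^bsub>A\<^esub> = 1 \<and>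
    (\<forall>x\<in>carrier A. \<forall>y\<in>carrier A. \<chi> (x \<otimes>\<^bsub>A\<^esub> y) = \<chi> x * \<chi> y)"

text \<open>
  For characters \<open>\<chi>\<close> and \<open>\<psi>\<close>, the Leibniz rule makes \<open>x \<mapsto> (\<chi> x, D x; 0, \<psi> x)\<close> a
  representation by upper triangular matrices, so that \<open>D\<close> is a cocycle for extensions of the one-dimensional modules \<open>\<chi>\<close> and \<open>\<psi>\<close>.
\<close>

definition twisted_derivation ::
    "('a, 'm) star_alg_scheme \<Rightarrow> ('a \<Rightarrow> complex) \<Rightarrow> ('a \<Rightarrow> complex) \<Rightarrow> ('a \<Rightarrow> complex) \<Rightarrow> bool"
  where "twisted_derivation A \<chi> \<psi> D \<longleftrightarrow> linear_functional A D \<and>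
    (\<forall>x\<in>carrier A. \<forall>y\<in>carrier A. D (x \<otimes>\<^bsub>A\<^esub> y) = \<chi> x * D y + D x * \<psi> y)"

lemma linear_functional_comp:
  assumes "h \<in> star_alg_hom A B" "linear_functional B f"
  shows "linear_functional A (f \<circ> h)"
  using assms unfolding linear_functional_def star_alg_hom_def ring_hom_def
  by (auto simp: Pi_iff)

lemma character_comp:
  assumes "h \<in> star_alg_hom A B" "character B \<chi>"
  shows "character A (\<chi> \<circ> h)"
  using assms linear_functional_comp[OF assms(1), of \<chi>]
  unfolding character_def star_alg_hom_def ring_hom_def
  by (auto simp: Pi_iff)

lemma twisted_derivation_comp:
  assumes "h \<in> star_alg_hom A B" "twisted_derivation B \<chi> \<psi> D"
  shows "twisted_derivation A (\<chi> \<circ> h) (\<psi> \<circ> h) (D \<circ> h)"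
  using assms linear_functional_comp[OF assms(1), of D]
  unfolding twisted_derivation_def star_alg_hom_def ring_hom_def
  by (auto simp: Pi_iff)

text \<open>The difference \<open>\<psi> - \<chi>\<close> is itself a derivation, since
  \<open>\<psi> x \<psi> y - \<chi> x \<chi> y = \<chi> x (\<psi> y - \<chi> y) + (\<psi> x - \<chi> x) \<psi> y\<close>.\<close>

lemma twisted_derivation_diff_scaled:
  assumes "character A \<chi>" "character A \<psi>" "twisted_derivation A \<chi> \<psi> D"
  shows "twisted_derivation A \<chi> \<psi> (\<lambda>x. D x - c * (\<psi> x - \<chi> x))"
  using assms unfolding twisted_derivation_def character_def linear_functional_def
  by (simp add: algebra_simps)

lemma twisted_derivation_zero: "twisted_derivation A \<chi> \<psi> (\<lambda>_. 0)"
  by (simp add: twisted_derivation_def linear_functional_def)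

text \<open>The functional induced on a quotient. The choice of a representative is harmless for
  linear functionals that vanish on the ideal.\<close>

definition on_coset :: "('a \<Rightarrow> complex) \<Rightarrow> 'a set \<Rightarrow> complex"
  where "on_coset f X = f (SOME x. x \<in> X)"

context star_ideal
begin

lemma on_coset_eq:
  assumes f: "linear_functional A f" "\<forall>i\<in>I. f i = 0" and x: "x \<in> carrier A"
  shows "on_coset f (I +> x) = f x"
proof -
  have "(SOME y. y \<in> I +> x) \<in> I +> x"
    using a_rcos_self[OF x] by (rule someI)
  then obtain i where "i \<in> I" "(SOME y. y \<in> I +> x) = i \<oplus> x"
    by (auto simp: a_r_coset_def r_coset_def)
  then show ?thesis
    using f x Icarr by (simp add: on_coset_def linear_functional_def)
qed

lemma projection_hom: "(\<lambda>x. I +> x) \<in> star_alg_hom A (star_quot A I)"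
  by (auto simp: star_alg_hom_def ring_hom_def star_quot_simps)

lemma linear_functional_quot:
  assumes f: "linear_functional A f" "\<forall>i\<in>I. f i = 0"
  shows "linear_functional (star_quot A I) (on_coset f)"
  using f(1) unfolding linear_functional_def
  by (auto simp: star_quot_simps on_coset_eq[OF f])

lemma character_quot:
  assumes f: "character A f" "\<forall>i\<in>I. f i = 0"
  shows "character (star_quot A I) (on_coset f)"
proof -
  have l: "linear_functional A f" using f(1) by (simp add: character_def)
  show ?thesis
    using f(1) linear_functional_quot[OF l f(2)] unfolding character_def
    by (auto simp: star_quot_simps on_coset_eq[OF l f(2)])
qed

lemma twisted_derivation_quot:
  assumes D: "twisted_derivation A \<chi> \<psi> D" "\<forall>i\<in>I. D i = 0"
    and \<chi>: "character A \<chi>" "\<forall>i\<in>I. \<chi> i = 0"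
    and \<psi>: "character A \<psi>" "\<forall>i\<in>I. \<psi> i = 0"
  shows "twisted_derivation (star_quot A I) (on_coset \<chi>) (on_coset \<psi>) (on_coset D)"
proof -
  have l: "linear_functional A D" "linear_functional A \<chi>" "linear_functional A \<psi>"
    using assms by (simp_all add: twisted_derivation_def character_def)
  show ?thesis
    using D(1) linear_functional_quot[OF l(1) D(2)] unfolding twisted_derivation_def
    by (auto simp: star_quot_simps on_coset_eq[OF l(1) D(2)] on_coset_eq[OF l(2) \<chi>(2)]
        on_coset_eq[OF l(3) \<psi>(2)])
qed

end

lemma star_alg_isomorphic_sym:
  assumes A: "star_algebra A" and B: "star_algebra B" and iso: "star_alg_isomorphic A B"
  shows "star_alg_isomorphic B A"
proof -
  interpret A: star_algebra A by (rule A)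
  interpret B: star_algebra B by (rule B)
  obtain h where h: "h \<in> star_alg_hom A B" and bij: "bij_betw h (carrier A) (carrier B)"
    using iso by (auto simp: star_alg_isomorphic_def star_alg_iso_def)
  let ?g = "inv_into (carrier A) h"
  have "h \<in> ring_iso A B"
    using h bij by (simp add: star_alg_hom_def ring_iso_def)
  then have ring: "?g \<in> ring_hom B A"
    using ring_iso_set_sym[OF A.ring_axioms] by (auto simp: ring_iso_def)
  have g: "?g y \<in> carrier A" "h (?g y) = y" if "y \<in> carrier B" for y
    using that bij by (auto simp: bij_betw_def inv_into_into f_inv_into_f)
  have gh: "?g (h x) = x" if "x \<in> carrier A" for x
    using that bij by (auto simp: bij_betw_def)
  have "?g (c \<odot>\<^bsub>B\<^esub> y) = c \<odot>\<^bsub>A\<^esub> ?g y" if y: "y \<in> carrier B" for c y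
  proof -
    have "h (c \<odot>\<^bsub>A\<^esub> ?g y) = c \<odot>\<^bsub>B\<^esub> y"
      using h g[OF y] by (simp add: star_alg_hom_def)
    then show ?thesis
      using gh[of "c \<odot>\<^bsub>A\<^esub> ?g y"] g[OF y] by simp
  qed
  moreover have "?g (adj B y) = adj A (?g y)" if y: "y \<in> carrier B" for y
  proof -
    have "h (adj A (?g y)) = adj B y"
      using h g[OF y] by (simp add: star_alg_hom_def)
    then show ?thesis
      using gh[of "adj A (?g y)"] g[OF y] by simp
  qed
  ultimately have "?g \<in> star_alg_iso B A"
    using ring bij_betw_inv_into[OF bij] by (simp add: star_alg_iso_def star_alg_hom_def)
  then show ?thesis
    by (auto simp: star_alg_isomorphic_def)
qed


section \<open>Functionals on the free algebra\<close>

lemma free_star_alg_simps: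
  "monoid.mult (free_star_alg G) = (*)" "one (free_star_alg G) = 1"
  "add (free_star_alg G) = (+)" "zero (free_star_alg G) = 0"
  "module.smult (free_star_alg G) = (\<lambda>c p. Poly_Mapping.single 0 c * p)"
  "adj (free_star_alg G) = adj_poly"
  by (simp_all add: free_star_alg_def)

lemma single_in_free:
  "Poly_Mapping.single (Word ls) c \<in> carrier (free_star_alg G)"
  if "letter_base ` set ls \<subseteq> G"
  using that by (auto simp: free_star_alg_def)

lemma free_closed:
  "a \<in> carrier (free_star_alg G) \<Longrightarrow> b \<in> carrier (free_star_alg G) \<Longrightarrow>
    a * b \<in> carrier (free_star_alg G)"
  "a \<in> carrier (free_star_alg G) \<Longrightarrow> Poly_Mapping.single 0 c * a \<in> carrier (free_star_alg G)"
  "g \<in> G \<Longrightarrow> free_gen g \<in> carrier (free_star_alg G)"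
  "g \<in> G \<Longrightarrow> adj_poly (free_gen g) \<in> carrier (free_star_alg G)"
  "1 \<in> carrier (free_star_alg G)"
proof -
  interpret F: star_algebra "free_star_alg G" by (rule star_algebra_free)
  show "a \<in> carrier (free_star_alg G) \<Longrightarrow> b \<in> carrier (free_star_alg G) \<Longrightarrow>
      a * b \<in> carrier (free_star_alg G)"
    "a \<in> carrier (free_star_alg G) \<Longrightarrow> Poly_Mapping.single 0 c * a \<in> carrier (free_star_alg G)"
    "1 \<in> carrier (free_star_alg G)"
    using F.m_closed[of a b] F.smult_closed[of a c] F.one_closed
    by (simp_all add: free_star_alg_simps)
  show gen: "g \<in> G \<Longrightarrow> free_gen g \<in> carrier (free_star_alg G)"
    by (simp add: free_star_alg_def free_gen_def)
  show "g \<in> G \<Longrightarrow> adj_poly (free_gen g) \<in> carrier (free_star_alg G)"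
    using F.adj_closed[of "free_gen g"] gen by (simp add: free_star_alg_simps)
qed

lemma linear_functional_diff:
  assumes f: "linear_functional (free_star_alg G) f"
    and ab: "a \<in> carrier (free_star_alg G)" "b \<in> carrier (free_star_alg G)"
  shows "f (a - b) = f a - f b \<and> a - b \<in> carrier (free_star_alg G)"
proof -
  interpret F: star_algebra "free_star_alg G" by (rule star_algebra_free)
  have diff: "a - b \<in> carrier (free_star_alg G)"
  proof -
    have "a + (- b) \<in> carrier (free_star_alg G)"
      using F.a_closed[of a "- b"] ab by (simp add: free_star_alg_simps) (simp add: free_star_alg_def)
    then show ?thesis by simp
  qed
  then have "f ((a - b) + b) = f (a - b) + f b"
    using f ab unfolding linear_functional_def by (metis free_star_alg_simps(3))
  then show ?thesis using diff by simp
qed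

lemma linear_functional_sum:
  assumes f: "linear_functional (free_star_alg G) f"
    and p: "\<forall>i\<in>K. p i \<in> carrier (free_star_alg G)"
  shows "f (\<Sum>i\<in>K. p i) = (\<Sum>i\<in>K. f (p i)) \<and> (\<Sum>i\<in>K. p i) \<in> carrier (free_star_alg G)"
proof -
  interpret F: star_algebra "free_star_alg G" by (rule star_algebra_free)
  have 0: "0 \<in> carrier (free_star_alg G)" by (simp add: free_star_alg_def)
  have "f (0 + 0) = f 0 + f 0"
    using f 0 unfolding linear_functional_def by (metis free_star_alg_simps(3))
  then have f0: "f 0 = 0" by simp
  show ?thesis
    using p
  proof (induction K rule: infinite_finite_induct)
    case (insert i K)
    then have "p i \<in> carrier (free_star_alg G)" "(\<Sum>i\<in>K. p i) \<in> carrier (free_star_alg G)"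
      by auto
    with insert show ?case
      using f F.a_closed[of "p i" "\<Sum>i\<in>K. p i"]
      by (simp add: linear_functional_def free_star_alg_simps)
  qed (use f0 0 in auto)
qed

text \<open>
  The Leibniz rule propagates zeros from letters to words, the empty word being covered by
  \<open>D 1 = D 1 + D 1\<close>. Since \<open>\<psi> - \<chi>\<close> is a derivation, this also compares characters.
\<close>

lemma twisted_derivation_eq_0:
  assumes D: "twisted_derivation (free_star_alg G) \<chi> \<psi> D" and one: "\<chi> 1 = 1" "\<psi> 1 = 1"
    and gen: "\<And>g. g \<in> G \<Longrightarrow> D (free_gen g) = 0"
      "\<And>g. g \<in> G \<Longrightarrow> D (adj_poly (free_gen g)) = 0"
    and p: "p \<in> carrier (free_star_alg G)"
  shows "D p = 0"
proof -
  let ?F = "free_star_alg G"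
  have add: "D (x + y) = D x + D y" and mult: "D (x * y) = \<chi> x * D y + D x * \<psi> y"
    and smult: "D (Poly_Mapping.single 0 c * x) = c * D x"
    if "x \<in> carrier ?F" "y \<in> carrier ?F" for x y c
    using D that by (simp_all add: twisted_derivation_def linear_functional_def free_star_alg_simps)
  have letter: "D (Poly_Mapping.single (Word [l]) 1) = 0" if "letter_base l \<in> G" for l
    using that gen by (cases l) (auto simp: free_gen_def adj_word_def)
  have one_F: "(1 :: 'a ncpoly) \<in> carrier ?F"
    using single_in_free[of "[]" G 1] by (simp flip: zero_word_def)
  have word: "D (Poly_Mapping.single (Word ls) 1) = 0" if "letter_base ` set ls \<subseteq> G" for ls
    using that
  proof (induction ls)
    case Nil
    have "D 1 = D 1 + D 1"
      using mult[OF one_F one_F] one by simp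
    then show ?case
      by (simp flip: zero_word_def)
  next
    case (Cons l ls)
    have "Poly_Mapping.single (Word (l # ls)) 1 =
        Poly_Mapping.single (Word [l]) 1 * Poly_Mapping.single (Word ls) (1::complex)"
      by (simp add: mult_single plus_word_def)
    moreover have "Poly_Mapping.single (Word [l]) 1 \<in> carrier ?F"
      "Poly_Mapping.single (Word ls) 1 \<in> carrier ?F"
      using Cons.prems by (auto intro!: single_in_free)
    ultimately show ?case
      using Cons mult letter by simp
  qed
  have monomial: "Poly_Mapping.single w c \<in> carrier ?F \<and> D (Poly_Mapping.single w c) = 0"
    if "w \<in> Poly_Mapping.keys p" for w c
  proof -
    obtain ls where w: "w = Word ls" by (cases w)
    have ls: "letter_base ` set ls \<subseteq> G"
      using p that w unfolding free_star_alg_def by fastforce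
    have "Poly_Mapping.single w c = Poly_Mapping.single 0 c * Poly_Mapping.single w 1"
      by (simp add: mult_single)
    moreover have "Poly_Mapping.single w 1 \<in> carrier ?F" "Poly_Mapping.single w c \<in> carrier ?F"
      using single_in_free[OF ls] w by simp_all
    ultimately show ?thesis
      using smult[of "Poly_Mapping.single w 1" "Poly_Mapping.single w 1" c] word[OF ls] w by simp
  qed
  have "(\<Sum>w\<in>K. Poly_Mapping.single w (Poly_Mapping.lookup p w)) \<in> carrier ?F \<and>
      D (\<Sum>w\<in>K. Poly_Mapping.single w (Poly_Mapping.lookup p w)) = 0"
    if "finite K" "K \<subseteq> Poly_Mapping.keys p" for K
    using that
  proof (induction K rule: finite_induct)
    case empty
    have "0 \<in> carrier ?F" by (simp add: free_star_alg_def)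
    then show ?case
      using add[of 0 0] by simp
  next
    case (insert w K)
    interpret F: star_algebra ?F by (rule star_algebra_free)
    show ?case
      using insert monomial[of w "Poly_Mapping.lookup p w"] add
        F.a_closed[of "Poly_Mapping.single w (Poly_Mapping.lookup p w)"
          "\<Sum>w\<in>K. Poly_Mapping.single w (Poly_Mapping.lookup p w)"]
      by (simp add: free_star_alg_simps)
  qed
  moreover have "p = (\<Sum>w\<in>Poly_Mapping.keys p. Poly_Mapping.single w (Poly_Mapping.lookup p w))"
    by (rule poly_mapping_eqI)
      (auto simp: lookup_sum lookup_single when_def not_in_keys_iff_lookup_eq_zero)
  ultimately show ?thesis
    using finite_keys[of p] by (metis order_refl)
qed

definition linear_ext :: "('g word \<Rightarrow> complex) \<Rightarrow> 'g ncpoly \<Rightarrow> complex"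
  where "linear_ext f p = (\<Sum>w\<in>Poly_Mapping.keys p. Poly_Mapping.lookup p w * f w)"

lemma linear_ext_superset:
  assumes "finite K" "Poly_Mapping.keys p \<subseteq> K"
  shows "linear_ext f p = (\<Sum>w\<in>K. Poly_Mapping.lookup p w * f w)"
  unfolding linear_ext_def using assms
  by (intro sum.mono_neutral_left) (auto simp: not_in_keys_iff_lookup_eq_zero)

lemma linear_ext_0 [simp]: "linear_ext f 0 = 0"
  by (simp add: linear_ext_def)

lemma linear_ext_single [simp]: "linear_ext f (Poly_Mapping.single w c) = c * f w"
  by (simp add: linear_ext_def)

lemma linear_ext_add: "linear_ext f (p + q) = linear_ext f p + linear_ext f q"
proof -
  let ?K = "Poly_Mapping.keys p \<union> Poly_Mapping.keys q"
  have "linear_ext f (p + q) = (\<Sum>w\<in>?K. Poly_Mapping.lookup (p + q) w * f w)"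
    using keys_add[of p q] by (intro linear_ext_superset) auto
  also have "\<dots> = linear_ext f p + linear_ext f q"
    by (simp add: linear_ext_superset[of ?K] lookup_add distrib_right sum.distrib)
  finally show ?thesis .
qed

lemma linear_ext_diff: "linear_ext f (p - q) = linear_ext f p - linear_ext f q"
  using linear_ext_add[of f "p - q" q] by simp

lemma linear_ext_sum: "linear_ext f (\<Sum>i\<in>K. p i) = (\<Sum>i\<in>K. linear_ext f (p i))"
  by (induction K rule: infinite_finite_induct) (simp_all add: linear_ext_add)

text \<open>A decomposition of \<open>f\<close> along concatenation of words passes to products of polynomials; the
  two summands on the right accommodate both multiplicative functionals and Leibniz rules.\<close>

lemma linear_ext_mult:
  assumes "\<And>v w. f (v + w) = a v * b w + c v * d w"
  shows "linear_ext f (p * q) =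
    linear_ext a p * linear_ext b q + linear_ext c p * linear_ext d q"
proof (induction p rule: ncpoly_induct)
  case (2 v x)
  show ?case
    by (induction q rule: ncpoly_induct)
      (simp_all add: mult_single assms linear_ext_add distrib_left algebra_simps)
qed (simp_all add: linear_ext_add distrib_right algebra_simps)

lemma linear_ext_adj: "linear_ext f (adj_poly p) = cnj (linear_ext (\<lambda>w. cnj (f (adj_word w))) p)"
  by (induction p rule: ncpoly_induct) (simp_all add: linear_ext_add adj_poly_add)

lemma linear_ext_smult: "linear_ext f (Poly_Mapping.single 0 c * p) = c * linear_ext f p"
  by (induction p rule: ncpoly_induct) (simp_all add: mult_single linear_ext_add distrib_left)

lemma linear_functional_linear_ext: "linear_functional (free_star_alg G) (linear_ext f)"
  by (simp add: linear_functional_def free_star_alg_simps linear_ext_add linear_ext_smult)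


section \<open>A family of characters and derivations of the spheres\<close>

text \<open>
  The character with parameter \<open>\<mu>\<close> sends \<open>z\<^sub>0\<close> to \<open>\<mu>\<close> and its adjoint to \<open>1 / \<mu>\<close>. It respects the
  involution only for \<open>\<mu>\<close> on the unit circle, but all nonzero \<open>\<mu>\<close> are needed, since
  multiplication by \<open>q\<close> leaves the circle.
\<close>

fun letter_char :: "complex \<Rightarrow> nat letter \<Rightarrow> complex" where
  "letter_char \<mu> (Gen i) = (if i = 0 then \<mu> else 0)"
| "letter_char \<mu> (Adj i) = (if i = 0 then inverse \<mu> else 0)"

abbreviation list_char :: "complex \<Rightarrow> nat letter list \<Rightarrow> complex"
  where "list_char \<mu> ls \<equiv> prod_list (map (letter_char \<mu>) ls)"

text \<open>Giving \<open>z\<^sub>1\<close> and its adjoint the same value \<open>1\<close> makes the family of derivations below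
  stable under the involution.\<close>

definition letter_der :: "nat letter \<Rightarrow> complex"
  where "letter_der l = (if letter_base l = 1 then 1 else 0)"

fun list_der :: "real \<Rightarrow> complex \<Rightarrow> nat letter list \<Rightarrow> complex" where
  "list_der q \<mu> [] = 0"
| "list_der q \<mu> (l # ls) =
    letter_char \<mu> l * list_der q \<mu> ls + letter_der l * list_char (q * \<mu>) ls"

definition point_char :: "complex \<Rightarrow> nat ncpoly \<Rightarrow> complex"
  where "point_char \<mu> = linear_ext (\<lambda>w. list_char \<mu> (letters w))"

definition point_der :: "real \<Rightarrow> complex \<Rightarrow> nat ncpoly \<Rightarrow> complex"
  where "point_der q \<mu> = linear_ext (\<lambda>w. list_der q \<mu> (letters w))"

lemma list_der_append:
  "list_der q \<mu> (ls @ ms) = list_char \<mu> ls * list_der q \<mu> ms + list_der q \<mu> ls * list_char (q * \<mu>) ms"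
  by (induction ls) (simp_all add: algebra_simps)

lemma point_char_mult: "point_char \<mu> (p * r) = point_char \<mu> p * point_char \<mu> r"
  unfolding point_char_def
  by (subst linear_ext_mult[where a = "\<lambda>w. list_char \<mu> (letters w)"
        and b = "\<lambda>w. list_char \<mu> (letters w)" and c = "\<lambda>_. 0" and d = "\<lambda>_. 0"])
    (simp_all add: plus_word_def linear_ext_def)

lemma point_der_mult:
  "point_der q \<mu> (p * r) = point_char \<mu> p * point_der q \<mu> r + point_der q \<mu> p * point_char (q * \<mu>) r"
  unfolding point_char_def point_der_def
  by (rule linear_ext_mult) (simp add: plus_word_def list_der_append)

lemma point_char_1 [simp]: "point_char \<mu> 1 = 1"
  unfolding point_char_def by (simp add: zero_word_def flip: single_one)

lemma point_der_1 [simp]: "point_der q \<mu> 1 = 0"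
  unfolding point_der_def by (simp add: zero_word_def flip: single_one)

lemma character_point_char: "character (free_star_alg G) (point_char \<mu>)"
  using linear_functional_linear_ext[of G "\<lambda>w. list_char \<mu> (letters w)"]
  by (simp add: character_def free_star_alg_simps point_char_mult flip: point_char_def)

lemma twisted_derivation_point_der:
  "twisted_derivation (free_star_alg G) (point_char \<mu>) (point_char (q * \<mu>)) (point_der q \<mu>)"
  using linear_functional_linear_ext[of G "\<lambda>w. list_der q \<mu> (letters w)"]
  by (simp add: twisted_derivation_def free_star_alg_simps point_der_mult flip: point_der_def)

lemma point_char_linear:
  "point_char \<mu> 0 = 0"
  "point_char \<mu> (p + r) = point_char \<mu> p + point_char \<mu> r"
  "point_char \<mu> (p - r) = point_char \<mu> p - point_char \<mu> r"
  "point_char \<mu> (Poly_Mapping.single 0 c * p) = c * point_char \<mu> p"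
  "point_char \<mu> (\<Sum>i\<in>K. f i) = (\<Sum>i\<in>K. point_char \<mu> (f i))"
  by (simp_all add: point_char_def linear_ext_add linear_ext_diff linear_ext_smult linear_ext_sum)

lemma point_der_linear:
  "point_der q \<mu> 0 = 0"
  "point_der q \<mu> (p + r) = point_der q \<mu> p + point_der q \<mu> r"
  "point_der q \<mu> (p - r) = point_der q \<mu> p - point_der q \<mu> r"
  "point_der q \<mu> (Poly_Mapping.single 0 c * p) = c * point_der q \<mu> p"
  "point_der q \<mu> (\<Sum>i\<in>K. f i) = (\<Sum>i\<in>K. point_der q \<mu> (f i))"
  by (simp_all add: point_der_def linear_ext_add linear_ext_diff linear_ext_smult linear_ext_sum)

lemma point_values:
  "point_char \<mu> (z_gen i) = (if i = 0 then \<mu> else 0)"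
  "point_char \<mu> (z_adj i) = (if i = 0 then inverse \<mu> else 0)"
  "point_der q \<mu> (z_gen i) = (if i = 1 then 1 else 0)"
  "point_der q \<mu> (z_adj i) = (if i = 1 then 1 else 0)"
  "point_char \<mu> (Poly_Mapping.single 0 c) = c"
  "point_der q \<mu> (Poly_Mapping.single 0 c) = 0"
  by (simp_all add: point_char_def point_der_def free_gen_def adj_word_def zero_word_def letter_der_def)

text \<open>
  The involution reverses products, so it exchanges the two ends of a derivation. The end points
  \<open>\<mu>\<close> and \<open>q * \<mu>\<close> become \<open>1 / (q * cnj \<mu>)\<close> and \<open>1 / cnj \<mu>\<close>, a pair of the same shape.
\<close>

lemma list_char_adj:
  "cnj (list_char \<mu> (rev (map adj_letter ls))) = list_char (inverse (cnj \<mu>)) ls"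
proof (induction ls)
  case (Cons l ls)
  then show ?case by (cases l) simp_all
qed simp

lemma list_der_adj:
  assumes "q \<noteq> 0"
  shows "cnj (list_der q \<mu> (rev (map adj_letter ls))) = list_der q (inverse (q * cnj \<mu>)) ls"
proof (induction ls)
  case (Cons l ls)
  have "of_real q * inverse (of_real q * cnj \<mu>) = inverse (cnj \<mu>)"
    using assms by simp
  moreover have "cnj (letter_char (of_real q * \<mu>) (adj_letter l)) =
      letter_char (inverse (of_real q * cnj \<mu>)) l"
    by (cases l) simp_all
  ultimately show ?case
    using Cons list_char_adj[of \<mu> ls] by (simp add: list_der_append letter_der_def del: inverse_mult_distrib)
qed simp

lemma point_char_adj: "point_char \<mu> (adj_poly p) = cnj (point_char (inverse (cnj \<mu>)) p)"
  by (simp add: point_char_def linear_ext_adj adj_word_def list_char_adj)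

lemma point_der_adj:
  assumes "q \<noteq> 0"
  shows "point_der q \<mu> (adj_poly p) = cnj (point_der q (inverse (q * cnj \<mu>)) p)"
  using assms by (simp add: point_der_def linear_ext_adj adj_word_def list_der_adj)

text \<open>
  The second point \<open>q * \<mu>\<close> is dictated by the relations between \<open>z\<^sub>0\<close> and \<open>z\<^sub>1\<close>. In the
  other relations every monomial is killed by the derivation, which is nonzero on a product of
  two letters only if one of them has index \<open>0\<close> and the other index \<open>1\<close>.
\<close>

lemma point_relations:
  assumes "r \<in> sphere_relations n q" "q \<noteq> 0" "\<mu> \<noteq> 0"
  shows "point_char \<mu> r = 0" "point_der q \<mu> r = 0"
proof -
  consider
    (comm) i j where "i < j" "r = z_gen j * z_gen i - scal q * (z_gen i * z_gen j)"
  | (adj_comm) i j where "i \<noteq> j" "r = z_adj i * z_gen j - scal q * (z_gen j * z_adj i)"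
  | (normal) i where "r = z_adj i * z_gen i -
      (z_gen i * z_adj i + scal (1 - q\<^sup>2) * (\<Sum>j = i + 1..n. z_gen j * z_adj j))"
  | (unit) "r = (\<Sum>i = 0..n. z_gen i * z_adj i) - 1"
    using assms(1) unfolding sphere_relations_def by blast
  then have "point_char \<mu> r = 0 \<and> point_der q \<mu> r = 0"
  proof cases
    case comm
    with assms show ?thesis
      by (simp add: point_char_linear point_der_linear point_char_mult point_der_mult point_values)
  next
    case adj_comm
    with assms show ?thesis
      by (simp add: point_char_linear point_der_linear point_char_mult point_der_mult point_values)
  next
    case normal
    with assms show ?thesis
      by (simp add: point_char_linear point_der_linear point_char_mult point_der_mult point_values)
  next
    case unit
    have "(\<Sum>i = 1..n. point_char \<mu> (z_gen i * z_adj i)) = 0"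
      "(\<Sum>i = 1..n. point_der q \<mu> (z_gen i * z_adj i)) = 0"
      by (simp_all add: point_char_mult point_der_mult point_values)
    with unit assms show ?thesis
      by (simp add: point_char_linear point_der_linear sum.atLeast_Suc_atMost
          point_char_mult point_der_mult point_values)
  qed
  then show "point_char \<mu> r = 0" "point_der q \<mu> r = 0"
    by simp_all
qed

abbreviation sphere_ideal :: "nat \<Rightarrow> real \<Rightarrow> nat ncpoly set"
  where "sphere_ideal n q \<equiv> gen_star_ideal (free_star_alg {0..n}) (sphere_relations n q)"

lemma star_ideal_sphere: "star_ideal (sphere_ideal n q) (free_star_alg {0..n})"
  by (intro star_algebra.gen_star_ideal star_algebra_free sphere_relations_subset)

lemma relations_in_ideal: "sphere_relations n q \<subseteq> sphere_ideal n q"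
  by (auto simp: gen_star_ideal_def)

text \<open>
  A single character need not vanish on a \<open>*\<close>-ideal just because it kills the generating relations. The
  common kernel over all \<open>\<mu> \<noteq> 0\<close>, however, is closed under the involution by
  \<open>point_char_adj\<close> and \<open>point_der_adj\<close>.
\<close>

lemma point_ideal:
  assumes r: "r \<in> sphere_ideal n q" and q: "q \<noteq> 0" and \<mu>: "\<mu> \<noteq> 0"
  shows "point_char \<mu> r = 0" "point_der q \<mu> r = 0"
proof -
  let ?F = "free_star_alg {0..n}"
  let ?K = "{p \<in> carrier ?F. \<forall>\<mu>. \<mu> \<noteq> 0 \<longrightarrow> point_char \<mu> p = 0 \<and> point_der q \<mu> p = 0}"
  interpret F: star_algebra ?F by (rule star_algebra_free)
  have minus: "\<ominus>\<^bsub>?F\<^esub> p = - p" if "p \<in> carrier ?F" for p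
  proof -
    have "\<ominus>\<^bsub>?F\<^esub> p + p = 0"
      using F.l_neg[OF that] by (simp add: free_star_alg_simps)
    then show ?thesis by (simp add: eq_neg_iff_add_eq_0)
  qed
  have "ideal ?K ?F"
  proof (rule idealI)
    show "ring ?F" by (rule F.ring_axioms)
    show "subgroup ?K (add_monoid ?F)"
    proof (rule group.subgroupI)
      show "group (add_monoid ?F)" by (rule F.a_group)
      show "?K \<noteq> {}"
        using F.zero_closed by (auto simp: free_star_alg_simps point_char_linear point_der_linear)
      show "inv\<^bsub>add_monoid ?F\<^esub> p \<in> ?K" if "p \<in> ?K" for p
      proof -
        have "- p \<in> carrier ?F"
          using that F.a_inv_closed[of p] minus[of p] by auto
        moreover have "point_char \<mu> (- p) = - point_char \<mu> p"
          "point_der q \<mu> (- p) = - point_der q \<mu> p" for \<mu>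
          using point_char_linear(3)[of \<mu> 0 p] point_der_linear(3)[of q \<mu> 0 p]
          by (simp_all add: point_char_linear(1) point_der_linear(1))
        ultimately have "- p \<in> ?K"
          using that by simp
        then show ?thesis
          using that minus[of p] by (simp add: a_inv_def)
      qed
      show "p \<otimes>\<^bsub>add_monoid ?F\<^esub> r \<in> ?K" if "p \<in> ?K" "r \<in> ?K" for p r
        using that F.a_closed[of p r]
        by (simp add: free_star_alg_simps point_char_linear point_der_linear)
    qed auto
  qed (use q F.m_closed in \<open>auto simp: free_star_alg_simps point_char_mult point_der_mult\<close>)
  then have "star_ideal ?K ?F"
  proof (intro star_ideal.intro star_ideal_axioms.intro star_algebra_free)
    show "adj ?F p \<in> ?K" if "p \<in> ?K" for p
      using that q F.adj_closed[of p]
      by (simp add: free_star_alg_simps point_char_adj point_der_adj)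
  qed
  moreover have "sphere_relations n q \<subseteq> ?K"
    using point_relations q sphere_relations_subset by blast
  ultimately have "sphere_ideal n q \<subseteq> ?K"
    by (auto simp: gen_star_ideal_def)
  then show "point_char \<mu> r = 0" "point_der q \<mu> r = 0"
    using r \<mu> by blast+
qed

text \<open>As a function of \<open>\<mu>\<close>, a word contributes a power of \<open>\<mu>\<close> with a possibly negative exponent;
  the factor \<open>\<mu> ^ N\<close> clears denominators.\<close>

lemma point_char_Laurent:
  "\<exists>N P. \<forall>\<mu>. \<mu> \<noteq> 0 \<longrightarrow> point_char \<mu> p * \<mu> ^ N = poly P \<mu>"
proof (induction p rule: ncpoly_induct)
  case 1
  show ?case by (intro exI[of _ 0]) (simp add: point_char_linear)
next
  case (2 w c)
  have "\<exists>N P. \<forall>\<mu>. \<mu> \<noteq> 0 \<longrightarrow> list_char \<mu> ls * \<mu> ^ N = poly P \<mu>" for ls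
  proof (induction ls)
    case Nil
    show ?case by (intro exI[of _ 0] exI[of _ 1]) simp
  next
    case (Cons l ls)
    then obtain N P where NP: "\<And>\<mu>. \<mu> \<noteq> 0 \<Longrightarrow> list_char \<mu> ls * \<mu> ^ N = poly P \<mu>" by blast
    have "\<exists>Q. \<forall>\<mu>. \<mu> \<noteq> 0 \<longrightarrow> letter_char \<mu> l * \<mu> = poly Q \<mu>"
    proof (cases "letter_base l = 0")
      case False
      then show ?thesis by (intro exI[of _ 0]) (cases l; simp)
    next
      case True
      then show ?thesis
        by (intro exI[of _ "case l of Gen _ \<Rightarrow> [:0, 0, 1:] | Adj _ \<Rightarrow> 1"]) (cases l; simp)
    qed
    then obtain Q where Q: "\<And>\<mu>. \<mu> \<noteq> 0 \<Longrightarrow> letter_char \<mu> l * \<mu> = poly Q \<mu>" by blast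
    have "list_char \<mu> (l # ls) * \<mu> ^ Suc N = poly (Q * P) \<mu>" if "\<mu> \<noteq> 0" for \<mu> :: complex
      by (simp add: mult_ac flip: NP[OF that] Q[OF that])
    then show ?case by blast
  qed
  then obtain N P where "\<And>\<mu>. \<mu> \<noteq> 0 \<Longrightarrow> list_char \<mu> (letters w) * \<mu> ^ N = poly P \<mu>" by blast
  then show ?case
    by (intro exI[of _ N] exI[of _ "smult c P"]) (simp add: point_char_def)
next
  case (3 p r)
  then obtain N P M Q where
    *: "\<And>\<mu>. \<mu> \<noteq> 0 \<Longrightarrow> point_char \<mu> p * \<mu> ^ N = poly P \<mu>"
      "\<And>\<mu>. \<mu> \<noteq> 0 \<Longrightarrow> point_char \<mu> r * \<mu> ^ M = poly Q \<mu>"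
    by blast
  have "point_char \<mu> (p + r) * \<mu> ^ (N + M) = poly (P * monom 1 M + Q * monom 1 N) \<mu>"
    if "\<mu> \<noteq> 0" for \<mu> :: complex
    by (simp add: point_char_linear poly_monom power_add algebra_simps flip: *[OF that])
  then show ?case by blast
qed


section \<open>Classification of characters and derivations\<close>

text \<open>The relations as identities between values of a functional, in the form in which they are
  evaluated by multiplicativity or the Leibniz rule.\<close>

lemma sphere_relation_values:
  assumes f: "linear_functional (free_star_alg {0..n}) f"
    and rel: "\<forall>r\<in>sphere_relations n q. f r = 0"
  shows "i < j \<Longrightarrow> j \<le> n \<Longrightarrow> f (z_gen j * z_gen i) = q * f (z_gen i * z_gen j)"
    and "i \<le> n \<Longrightarrow> j \<le> n \<Longrightarrow> i \<noteq> j \<Longrightarrow> f (z_adj i * z_gen j) = q * f (z_gen j * z_adj i)"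
    and "i \<le> n \<Longrightarrow> f (z_adj i * z_gen i) =
      f (z_gen i * z_adj i) + (1 - q\<^sup>2) * (\<Sum>j = i + 1..n. f (z_gen j * z_adj j))"
    and "(\<Sum>i = 0..n. f (z_gen i * z_adj i)) = f 1"
proof -
  let ?F = "free_star_alg {0..n}"
  have diff: "f (a - Poly_Mapping.single 0 c * b) = f a - c * f b"
    if "a \<in> carrier ?F" "b \<in> carrier ?F" for a b c
    using linear_functional_diff[OF f that(1) free_closed(2)[OF that(2)]] f that
    by (simp add: linear_functional_def free_star_alg_simps)
  have z: "z_gen i \<in> carrier ?F" "z_adj i \<in> carrier ?F" if "i \<le> n" for i
    using that by (simp_all add: free_closed)
  show "f (z_gen j * z_gen i) = q * f (z_gen i * z_gen j)" if "i < j" "j \<le> n"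
  proof -
    have "z_gen j * z_gen i - scal q * (z_gen i * z_gen j) \<in> sphere_relations n q"
      using that by (auto simp: sphere_relations_def)
    then show ?thesis
      using rel diff that z by (force simp: free_closed(1))
  qed
  show "f (z_adj i * z_gen j) = q * f (z_gen j * z_adj i)" if "i \<le> n" "j \<le> n" "i \<noteq> j"
  proof -
    have "z_adj i * z_gen j - scal q * (z_gen j * z_adj i) \<in> sphere_relations n q"
      using that by (auto simp: sphere_relations_def)
    then show ?thesis
      using rel diff that z by (force simp: free_closed(1))
  qed
  have zz: "z_gen i * z_adj i \<in> carrier ?F" if "i \<le> n" for i
    using that by (simp add: free_closed)
  have sum: "f (\<Sum>j\<in>K. z_gen j * z_adj j) = (\<Sum>j\<in>K. f (z_gen j * z_adj j))"
    "(\<Sum>j\<in>K. z_gen j * z_adj j) \<in> carrier ?F" if "K \<subseteq> {..n}" for K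
    using linear_functional_sum[OF f, of K "\<lambda>j. z_gen j * z_adj j"] that zz by auto
  show "f (z_adj i * z_gen i) =
      f (z_gen i * z_adj i) + (1 - q\<^sup>2) * (\<Sum>j = i + 1..n. f (z_gen j * z_adj j))" if i: "i \<le> n"
  proof -
    let ?a = "z_adj i * z_gen i" and ?b = "z_gen i * z_adj i"
      and ?s = "\<Sum>j = i + 1..n. z_gen j * z_adj j"
    have s: "?s \<in> carrier ?F" "f ?s = (\<Sum>j = i + 1..n. f (z_gen j * z_adj j))"
      using sum[of "{i + 1..n}"] by auto
    have ab: "?a \<in> carrier ?F" "?b \<in> carrier ?F"
      using i by (simp_all add: free_closed)
    have "?a - (?b + scal (1 - q\<^sup>2) * ?s) \<in> sphere_relations n q"
      unfolding sphere_relations_def using i by blast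
    then have "f (?a - (?b + scal (1 - q\<^sup>2) * ?s)) = 0"
      using rel by blast
    then have "f ((?a - ?b) - scal (1 - q\<^sup>2) * ?s) = 0"
      by (simp only: diff_diff_eq)
    then have "f ?a - f ?b - complex_of_real (1 - q\<^sup>2) * f ?s = 0"
      using diff[OF _ s(1), of "?a - ?b"] linear_functional_diff[OF f ab] by simp
    then show ?thesis
      unfolding s(2) by (simp add: algebra_simps)
  qed
  have "(\<Sum>i = 0..n. z_gen i * z_adj i) - 1 \<in> sphere_relations n q"
    by (auto simp: sphere_relations_def)
  then have "f ((\<Sum>i = 0..n. z_gen i * z_adj i) - 1) = 0" using rel by blast
  then show "(\<Sum>i = 0..n. f (z_gen i * z_adj i)) = f 1"
    using sum[of "{0..n}"] linear_functional_diff[OF f _ free_closed(5)] by auto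
qed

text \<open>
  For a character the third relation at \<open>i = 0\<close> says that the products \<open>\<chi> z\<^sub>j * \<chi> z\<^sub>j\<^sup>*\<close> with
  \<open>j \<ge> 1\<close> sum to zero. The sphere equation then leaves \<open>\<chi> z\<^sub>0 * \<chi> z\<^sub>0\<^sup>* = 1\<close>, and commuting \<open>z\<^sub>j\<close>
  past the invertible value at \<open>z\<^sub>0\<close> costs a factor \<open>q \<noteq> 1\<close>, so the other values are zero.
\<close>

lemma sphere_character_values:
  assumes \<chi>: "character (free_star_alg {0..n}) \<chi>"
    and rel: "\<forall>r\<in>sphere_relations n q. \<chi> r = 0"
    and q: "0 \<le> q" "q < 1"
  shows "\<chi> (z_gen 0) \<noteq> 0"
    and "0 < j \<Longrightarrow> j \<le> n \<Longrightarrow> \<chi> (z_gen j) = 0"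
    and "0 < j \<Longrightarrow> j \<le> n \<Longrightarrow> \<chi> (z_adj j) = 0"
proof -
  let ?F = "free_star_alg {0..n}"
  have lin: "linear_functional ?F \<chi>" and one: "\<chi> 1 = 1"
    and mult: "\<And>x y. x \<in> carrier ?F \<Longrightarrow> y \<in> carrier ?F \<Longrightarrow> \<chi> (x * y) = \<chi> x * \<chi> y"
    using \<chi> by (simp_all add: character_def free_star_alg_simps)
  note vals = sphere_relation_values[OF lin rel]
  have z: "z_gen i \<in> carrier ?F" "z_adj i \<in> carrier ?F" if "i \<le> n" for i
    using that by (simp_all add: free_closed)
  have "(1 - (complex_of_real q)\<^sup>2) * (\<Sum>j = 1..n. \<chi> (z_gen j * z_adj j)) = 0"
    using vals(3)[of 0] z[of 0] by (simp add: mult)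
  moreover have "q\<^sup>2 < 1"
    using q power_strict_mono[of q 1 2] by simp
  then have "1 - (complex_of_real q)\<^sup>2 \<noteq> 0"
    by (metis eq_iff_diff_eq_0 less_irrefl of_real_1 of_real_eq_iff of_real_power)
  ultimately have "(\<Sum>j = 1..n. \<chi> (z_gen j * z_adj j)) = 0"
    by simp
  moreover have "(\<Sum>i = 0..n. \<chi> (z_gen i * z_adj i)) = 1"
    using vals(4) one by simp
  ultimately have "\<chi> (z_gen 0 * z_adj 0) = 1"
    by (simp add: sum.atLeast_Suc_atMost)
  then show ne: "\<chi> (z_gen 0) \<noteq> 0"
    using z[of 0] by (auto simp: mult)
  show "\<chi> (z_gen j) = 0" if j: "0 < j" "j \<le> n"
  proof -
    have "\<chi> (z_gen j) * \<chi> (z_gen 0) = q * (\<chi> (z_gen 0) * \<chi> (z_gen j))"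
      using vals(1)[OF j] z[of 0] z[OF j(2)] by (simp add: mult)
    then have "(1 - complex_of_real q) * (\<chi> (z_gen j) * \<chi> (z_gen 0)) = 0"
      by (simp add: algebra_simps)
    then show ?thesis using ne q by auto
  qed
  show "\<chi> (z_adj j) = 0" if j: "0 < j" "j \<le> n"
  proof -
    have "\<chi> (z_adj j) * \<chi> (z_gen 0) = q * (\<chi> (z_gen 0) * \<chi> (z_adj j))"
      using vals(2)[OF j(2), of 0] z[of 0] z[OF j(2)] j by (simp add: mult)
    then have "(1 - complex_of_real q) * (\<chi> (z_adj j) * \<chi> (z_gen 0)) = 0"
      by (simp add: algebra_simps)
    then show ?thesis using ne q by auto
  qed
qed

text \<open>
  With \<open>D z\<^sub>0 = 0\<close>, the sphere equation gives \<open>D z\<^sub>0\<^sup>* = 0\<close>: in the remaining products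
  \<open>z\<^sub>i z\<^sub>i\<^sup>*\<close> both factors are killed by \<open>\<chi>\<close> and \<open>\<psi>\<close>. For \<open>j \<ge> 1\<close>, the relation between \<open>z\<^sub>j\<close> or
  its adjoint and \<open>z\<^sub>0\<close> says that its value under \<open>D\<close> times \<open>\<psi> z\<^sub>0 - q * \<chi> z\<^sub>0\<close> is zero.
\<close>

lemma sphere_derivation_eq_0:
  assumes \<chi>: "character (free_star_alg {0..n}) \<chi>" "\<forall>r\<in>sphere_relations n q. \<chi> r = 0"
    and \<psi>: "character (free_star_alg {0..n}) \<psi>" "\<forall>r\<in>sphere_relations n q. \<psi> r = 0"
    and D: "twisted_derivation (free_star_alg {0..n}) \<chi> \<psi> D"
      "\<forall>r\<in>sphere_relations n q. D r = 0"
    and q: "0 \<le> q" "q < 1"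
    and z0: "D (z_gen 0) = 0" and ne: "\<psi> (z_gen 0) \<noteq> q * \<chi> (z_gen 0)"
    and p: "p \<in> carrier (free_star_alg {0..n})"
  shows "D p = 0"
proof -
  let ?F = "free_star_alg {0..n}"
  have lin: "linear_functional ?F D"
    and mult: "\<And>x y. x \<in> carrier ?F \<Longrightarrow> y \<in> carrier ?F \<Longrightarrow> D (x * y) = \<chi> x * D y + D x * \<psi> y"
    and one: "\<chi> 1 = 1" "\<psi> 1 = 1"
    using \<chi> \<psi> D by (simp_all add: twisted_derivation_def character_def free_star_alg_simps)
  note vals = sphere_relation_values[OF lin D(2)]
  note \<chi>_vals = sphere_character_values[OF \<chi> q]
  note \<psi>_vals = sphere_character_values[OF \<psi> q]
  have z: "z_gen i \<in> carrier ?F" "z_adj i \<in> carrier ?F" if "i \<le> n" for i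
    using that by (simp_all add: free_closed)
  have "D 1 = D 1 + D 1"
    using mult[OF free_closed(5) free_closed(5)] one by simp
  moreover have "D (z_gen i * z_adj i) = 0" if "i \<in> {1..n}" for i
    using that z[of i] by (simp add: mult \<chi>_vals \<psi>_vals)
  ultimately have "D (z_gen 0 * z_adj 0) = 0"
    using vals(4) by (simp add: sum.atLeast_Suc_atMost)
  then have za0: "D (z_adj 0) = 0"
    using z[of 0] \<chi>_vals(1) z0 by (simp add: mult)
  have zj: "D (z_gen j) = 0" if j: "0 < j" "j \<le> n" for j
  proof -
    have "D (z_gen j) * \<psi> (z_gen 0) = q * (\<chi> (z_gen 0) * D (z_gen j))"
      using vals(1)[OF j] z[of 0] z[OF j(2)] z0 by (simp add: mult)
    then have "(\<psi> (z_gen 0) - q * \<chi> (z_gen 0)) * D (z_gen j) = 0"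
      by (simp add: algebra_simps)
    then show ?thesis using ne by simp
  qed
  have zaj: "D (z_adj j) = 0" if j: "0 < j" "j \<le> n" for j
  proof -
    have "D (z_adj j) * \<psi> (z_gen 0) = q * (\<chi> (z_gen 0) * D (z_adj j))"
      using vals(2)[OF j(2), of 0] j z[of 0] z[OF j(2)] z0 by (simp add: mult)
    then have "(\<psi> (z_gen 0) - q * \<chi> (z_gen 0)) * D (z_adj j) = 0"
      by (simp add: algebra_simps)
    then show ?thesis using ne by simp
  qed
  show ?thesis
    using D(1) one
  proof (rule twisted_derivation_eq_0)
    show "D (free_gen g) = 0" "D (adj_poly (free_gen g)) = 0" if "g \<in> {0..n}" for g
      using that z0 za0 zj zaj by (cases "g = 0"; simp)+
  qed (rule p)
qed

text \<open>
  If \<open>\<chi>\<close> and \<open>\<psi>\<close> agreed at \<open>z\<^sub>0\<close>, the previous lemma applied to \<open>\<psi> - \<chi>\<close> would make them equal.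
  So \<open>\<psi> - \<chi>\<close> can be scaled to cancel \<open>D\<close> at \<open>z\<^sub>0\<close>, and the previous lemma applies to the
  difference.
\<close>

lemma sphere_derivation_inner:
  assumes \<chi>: "character (free_star_alg {0..n}) \<chi>" "\<forall>r\<in>sphere_relations n q. \<chi> r = 0"
    and \<psi>: "character (free_star_alg {0..n}) \<psi>" "\<forall>r\<in>sphere_relations n q. \<psi> r = 0"
    and D: "twisted_derivation (free_star_alg {0..n}) \<chi> \<psi> D"
      "\<forall>r\<in>sphere_relations n q. D r = 0"
    and q: "0 \<le> q" "q < 1"
    and distinct: "x \<in> carrier (free_star_alg {0..n})" "\<chi> x \<noteq> \<psi> x"
    and ne: "\<psi> (z_gen 0) \<noteq> q * \<chi> (z_gen 0)"
  shows "\<exists>c. \<forall>p \<in> carrier (free_star_alg {0..n}). D p = c * (\<psi> p - \<chi> p)"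
proof -
  have neq: "\<psi> (z_gen 0) - \<chi> (z_gen 0) \<noteq> 0"
  proof
    assume eq: "\<psi> (z_gen 0) - \<chi> (z_gen 0) = 0"
    have "twisted_derivation (free_star_alg {0..n}) \<chi> \<psi> (\<lambda>p. 0 - (-1) * (\<psi> p - \<chi> p))"
      by (rule twisted_derivation_diff_scaled[OF \<chi>(1) \<psi>(1) twisted_derivation_zero])
    from sphere_derivation_eq_0[OF \<chi> \<psi> this _ q _ ne distinct(1)]
    have "\<psi> x - \<chi> x = 0"
      using eq \<chi>(2) \<psi>(2) by simp
    then show False using distinct(2) by simp
  qed
  define c where "c = D (z_gen 0) / (\<psi> (z_gen 0) - \<chi> (z_gen 0))"
  note der = twisted_derivation_diff_scaled[OF \<chi>(1) \<psi>(1) D(1), of c]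
  have vanish: "\<forall>r\<in>sphere_relations n q. D r - c * (\<psi> r - \<chi> r) = 0"
    using \<chi>(2) \<psi>(2) D(2) by simp
  have z0: "D (z_gen 0) - c * (\<psi> (z_gen 0) - \<chi> (z_gen 0)) = 0"
    using neq by (simp add: c_def)
  have "D p - c * (\<psi> p - \<chi> p) = 0" if "p \<in> carrier (free_star_alg {0..n})" for p
    by (rule sphere_derivation_eq_0[OF \<chi> \<psi> der vanish q z0 ne that])
  then show ?thesis by (intro exI[of _ c]) simp
qed


section \<open>Comparing two spheres\<close>

text \<open>The substitution \<open>x \<mapsto> a x\<close> is diagonal on monomials, with the powers of \<open>a\<close> as eigenvalues.\<close>

lemma poly_eigenvalue_is_power:
  fixes P :: "complex poly"
  assumes "P \<noteq> 0" and eq: "\<And>x. x \<noteq> 0 \<Longrightarrow> poly P (a * x) = b * poly P x"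
  shows "\<exists>j. b = a ^ j"
proof -
  have "poly (pcompose P [:0, a:] - smult b P) x = 0" if "x \<in> - {0}" for x
    using that eq[of x] by (simp add: poly_pcompose mult.commute)
  then have "- {0} \<subseteq> {x. poly (pcompose P [:0, a:] - smult b P) x = 0}"
    by blast
  moreover have "infinite (- {0 :: complex})"
    by (simp add: infinite_UNIV_char_0 Compl_eq_Diff_UNIV)
  ultimately have "pcompose P [:0, a:] - smult b P = 0"
    using poly_roots_finite finite_subset by blast
  then have "pcompose P [:0, a:] = smult b P"
    by simp
  then have "coeff (pcompose P [:0, a:]) (degree P) = coeff (smult b P) (degree P)"
    by (rule arg_cong)
  then have "a ^ degree P * coeff P (degree P) = b * coeff P (degree P)"
    by (simp only: coeff_pcompose_linear coeff_smult)
  with \<open>P \<noteq> 0\<close> show ?thesis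
    by (intro exI[of _ "degree P"]) simp
qed

text \<open>
  The functionals of the target sphere are pulled back along the surjection \<open>g\<close> from the free
  algebra, where the classification for the source sphere applies to them.
\<close>

lemma isomorphic_spheres_le:
  assumes n: "n \<ge> 1" and q: "0 \<le> q" "q < 1" and q': "0 < q'" "q' < 1"
    and iso: "star_alg_isomorphic (quantum_sphere n q) (quantum_sphere n q')"
  shows "0 < q \<and> q \<le> q'"
proof -
  let ?F = "free_star_alg {0..n}"
  let ?I = "sphere_ideal n q" and ?J = "sphere_ideal n q'"
  interpret I: star_ideal ?I ?F by (rule star_ideal_sphere)
  interpret J: star_ideal ?J ?F by (rule star_ideal_sphere)
  obtain h where h: "h \<in> star_alg_hom (quantum_sphere n q) (quantum_sphere n q')"
    and bij: "bij_betw h (carrier (quantum_sphere n q)) (carrier (quantum_sphere n q'))"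
    using iso by (auto simp: star_alg_isomorphic_def star_alg_iso_def)
  define g where "g = h \<circ> (\<lambda>x. ?I +>\<^bsub>?F\<^esub> x)"
  have pull: "character ?F (\<chi> \<circ> g)" if "character (quantum_sphere n q') \<chi>" for \<chi>
    using character_comp[OF I.projection_hom character_comp[OF h that, unfolded quantum_sphere_def]]
    by (simp add: g_def comp_def)
  have pull_D: "twisted_derivation ?F (\<chi> \<circ> g) (\<psi> \<circ> g) (D \<circ> g)"
    if "twisted_derivation (quantum_sphere n q') \<chi> \<psi> D" for \<chi> \<psi> D
    using twisted_derivation_comp[OF I.projection_hom
        twisted_derivation_comp[OF h that, unfolded quantum_sphere_def]]
    by (simp add: g_def comp_def)
  have g_surj: "\<exists>x\<in>carrier ?F. g x = ?J +>\<^bsub>?F\<^esub> y" if "y \<in> carrier ?F" for y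
  proof -
    have "?J +>\<^bsub>?F\<^esub> y \<in> h ` carrier (quantum_sphere n q)"
      using bij that by (auto simp: bij_betw_def quantum_sphere_def J.star_quot_simps)
    then show ?thesis
      by (auto simp: quantum_sphere_def I.star_quot_simps g_def)
  qed
  have g_into: "\<exists>y\<in>carrier ?F. g x = ?J +>\<^bsub>?F\<^esub> y" if "x \<in> carrier ?F" for x
  proof -
    have "g x \<in> carrier (quantum_sphere n q')"
      using bij that by (auto simp: bij_betw_def quantum_sphere_def I.star_quot_simps g_def)
    then show ?thesis
      by (auto simp: quantum_sphere_def J.star_quot_simps)
  qed
  have g_rel: "g r = g \<zero>\<^bsub>?F\<^esub>" if "r \<in> sphere_relations n q" for r
  proof -
    have "r \<in> ?I" using that relations_in_ideal by blast
    then have "?I +>\<^bsub>?F\<^esub> r = ?I +>\<^bsub>?F\<^esub> \<zero>\<^bsub>?F\<^esub>"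
      by (metis I.a_coset_join2 I.a_subgroup I.additive_subgroup_axioms I.zero_closed
          I.Icarr additive_subgroup.zero_closed)
    then show ?thesis by (simp add: g_def)
  qed
  have vanish: "\<forall>r\<in>sphere_relations n q. (f \<circ> g) r = 0" if f: "linear_functional ?F (f \<circ> g)" for f
  proof
    fix r assume r: "r \<in> sphere_relations n q"
    have "(f \<circ> g) (\<zero>\<^bsub>?F\<^esub> \<oplus>\<^bsub>?F\<^esub> \<zero>\<^bsub>?F\<^esub>) =
        (f \<circ> g) \<zero>\<^bsub>?F\<^esub> + (f \<circ> g) \<zero>\<^bsub>?F\<^esub>"
      using f I.zero_closed unfolding linear_functional_def by blast
    then show "(f \<circ> g) r = 0" using g_rel[OF r] by simp
  qed
  have vanish_char: "\<forall>r\<in>sphere_relations n q. (f \<circ> g) r = 0" if "character ?F (f \<circ> g)" for f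
    using that vanish unfolding character_def by blast
  define X where "X \<mu> = on_coset (point_char \<mu>)" for \<mu>
  define D where "D \<mu> = on_coset (point_der q' \<mu>)" for \<mu>
  have X: "character (quantum_sphere n q') (X \<mu>)" if "\<mu> \<noteq> 0" for \<mu> :: complex
    unfolding X_def quantum_sphere_def
    using J.character_quot[OF character_point_char] point_ideal(1) that q'(1) by auto
  have D: "twisted_derivation (quantum_sphere n q') (X \<mu>) (X (q' * \<mu>)) (D \<mu>)"
    if "\<mu> \<noteq> 0" for \<mu> :: complex
    unfolding X_def D_def quantum_sphere_def
    by (rule J.twisted_derivation_quot[OF twisted_derivation_point_der _ character_point_char _
          character_point_char])
      (use point_ideal that q'(1) in auto)
  have X_eq: "X \<mu> (?J +>\<^bsub>?F\<^esub> y) = point_char \<mu> y"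
    and D_eq: "D \<mu> (?J +>\<^bsub>?F\<^esub> y) = point_der q' \<mu> y" if "\<mu> \<noteq> 0" "y \<in> carrier ?F" for \<mu> y
    unfolding X_def D_def point_char_def point_der_def
    by (rule J.on_coset_eq[OF linear_functional_linear_ext _ that(2)];
      use point_ideal[OF _ _ that(1)] q'(1) in \<open>fastforce simp: point_char_def point_der_def\<close>)+
  have z: "z_gen 0 \<in> carrier ?F" "z_gen 1 \<in> carrier ?F"
    using n by (simp_all add: free_closed)
  have scale: "X (q' * \<mu>) (g (z_gen 0)) = q * X \<mu> (g (z_gen 0))" if \<mu>: "\<mu> \<noteq> 0" for \<mu> :: complex
  proof (rule ccontr)
    assume ne: "X (q' * \<mu>) (g (z_gen 0)) \<noteq> q * X \<mu> (g (z_gen 0))"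
    have q\<mu>: "q' * \<mu> \<noteq> 0" using q' \<mu> by simp
    have q1: "q' * \<mu> \<noteq> \<mu>" using q' \<mu> by simp
    note chars = pull[OF X[OF \<mu>]] pull[OF X[OF q\<mu>]]
    note der = pull_D[OF D[OF \<mu>]]
    obtain x where x: "x \<in> carrier ?F" "g x = ?J +>\<^bsub>?F\<^esub> z_gen 0"
      using g_surj z(1) by blast
    have vanish_der: "\<forall>r\<in>sphere_relations n q. (D \<mu> \<circ> g) r = 0"
      using der vanish unfolding twisted_derivation_def by blast
    have distinct: "(X \<mu> \<circ> g) x \<noteq> (X (q' * \<mu>) \<circ> g) x"
      using x(2) z X_eq \<mu> q\<mu> q1 by (simp add: point_values)
    have ne': "(X (q' * \<mu>) \<circ> g) (z_gen 0) \<noteq> q * (X \<mu> \<circ> g) (z_gen 0)"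
      using ne by simp
    have "\<exists>c. \<forall>p\<in>carrier ?F. (D \<mu> \<circ> g) p = c * ((X (q' * \<mu>) \<circ> g) p - (X \<mu> \<circ> g) p)"
      by (rule sphere_derivation_inner[OF chars(1) vanish_char[OF chars(1)] chars(2)
            vanish_char[OF chars(2)] der vanish_der q x(1) distinct ne'])
    then obtain c where c: "\<And>p. p \<in> carrier ?F \<Longrightarrow> D \<mu> (g p) = c * (X (q' * \<mu>) (g p) - X \<mu> (g p))"
      by auto
    have c': "point_der q' \<mu> y = c * (point_char (q' * \<mu>) y - point_char \<mu> y)"
      if y: "y \<in> carrier ?F" for y
    proof -
      obtain p where "p \<in> carrier ?F" "g p = ?J +>\<^bsub>?F\<^esub> y"
        using g_surj y by blast
      then show ?thesis
        using c[of p] X_eq D_eq \<mu> q\<mu> y by simp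
    qed
    \<comment> \<open>The derivation vanishes at \<open>z\<^sub>0\<close>, where the two characters differ, so \<open>c = 0\<close>; but it is
      \<open>1\<close> at \<open>z\<^sub>1\<close>, which exists because \<open>n \<ge> 1\<close>.\<close>
    show False
      using c'[OF z(1)] c'[OF z(2)] q1 by (simp add: point_values)
  qed
  obtain y where y: "y \<in> carrier ?F" "g (z_gen 0) = ?J +>\<^bsub>?F\<^esub> y"
    using g_into z(1) by blast
  have scale_y: "point_char (q' * \<mu>) y = q * point_char \<mu> y" if "\<mu> \<noteq> 0" for \<mu> :: complex
    using scale[OF that] X_eq[OF _ y(1)] y(2) that q' by simp
  have nonzero: "point_char \<mu> y \<noteq> 0" if "\<mu> \<noteq> 0" for \<mu> :: complex
  proof -
    note \<chi> = pull[OF X[OF that]]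
    have "(X \<mu> \<circ> g) (z_gen 0) \<noteq> 0"
      by (rule sphere_character_values(1)[OF \<chi> vanish_char[OF \<chi>] q])
    then show ?thesis
      using X_eq[OF that y(1)] y(2) by simp
  qed
  obtain N P where P: "\<And>\<mu>. \<mu> \<noteq> 0 \<Longrightarrow> point_char \<mu> y * \<mu> ^ N = poly P \<mu>"
    using point_char_Laurent by blast
  have "P \<noteq> 0"
    using P[of 1] nonzero[of 1] by auto
  moreover have "poly P (q' * \<mu>) = (q * q' ^ N) * poly P \<mu>" if "\<mu> \<noteq> 0" for \<mu> :: complex
    using scale_y[OF that] that q' by (simp add: power_mult_distrib mult_ac flip: P)
  ultimately obtain j where "complex_of_real (q * q' ^ N) = complex_of_real q' ^ j"
    using poly_eigenvalue_is_power[of P "complex_of_real q'" "complex_of_real (q * q' ^ N)"] by auto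
  then have j: "q * q' ^ N = q' ^ j"
    by (metis of_real_eq_iff of_real_power)
  \<comment> \<open>The bound \<open>q < 1\<close> excludes exponents \<open>j - N \<le> 0\<close>.\<close>
  have "q' ^ j < q' ^ N"
    using q q' by (simp flip: j)
  then have "N < j"
    using q' by (metis linorder_not_less power_decreasing less_imp_le)
  then obtain k where k: "j = N + Suc k"
    using less_imp_Suc_add by auto
  then have "q * q' ^ N = q' ^ Suc k * q' ^ N"
    using j by (simp add: power_add mult_ac)
  then have "q = q' ^ Suc k"
    using q' by simp
  then show ?thesis
    using q' power_le_one[of q' k] by (simp add: mult_left_le)
qed

theorem theorem1:
  fixes n :: nat and q q' :: real
  assumes "n \<ge> 1"
    and "q \<in> {0..<1}"
    and "q' \<in> {0..<1}"
    and "q \<noteq> q'"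
  shows "\<not> star_alg_isomorphic (quantum_sphere n q) (quantum_sphere n q')"
proof
  assume iso: "star_alg_isomorphic (quantum_sphere n q) (quantum_sphere n q')"
  note iso' = star_alg_isomorphic_sym[OF star_algebra_quantum_sphere star_algebra_quantum_sphere iso]
  have "q' > 0 \<Longrightarrow> 0 < q \<and> q \<le> q'" "q > 0 \<Longrightarrow> 0 < q' \<and> q' \<le> q"
    using isomorphic_spheres_le[OF assms(1) _ _ _ _ iso] isomorphic_spheres_le[OF assms(1) _ _ _ _ iso']
      assms by auto
  then show False
    using assms by fastforce
qed

end
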